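(* Let $q$ be an odd prime power and let $n$ be an even integer with $2\leq n\leq q-1$. Let $\mathcal{A}$ be the collection of subsets $\mathcal{S}=\{\alpha_1,\dots,\alpha_n\}\subseteq\mathbb{F}_q$ of size $n$ satisfying: (i) $\eta(\Delta_{\mathcal{S}}(\alpha_i))=1$ for all $i=1,\dots,n$; (ii) writing $\mathbb{F}_q\setminus\mathcal{S}=\{\beta_1,\dots,\beta_{q-n}\}$, $\eta(\Delta_{\mathbb{F}_q\setminus\mathcal{S}}(\beta_s))=1$ for all $s=1,\dots,q-n$. If $q\equiv 1\pmod 8$, then for every $\mathcal{S}\in\mathcal{A}$ there exists $\boldsymbol v\in(\mathbb{F}_q^* )^n$ such that $GRS_{n/2}(\boldsymbol\alpha,\boldsymbol v)$ is an MDS self-dual code of length $n$, and there exists $\boldsymbol w\in(\mathbb{F}_q^* )^{q-n}$ such that $GRS_{(q-n+1)/2}(\boldsymbol\beta,\boldsymbol w,\infty)$ is an MDS self-dual code of length $q-n+1$; moreover $|\mathcal{A}|=2^{\frac{q-1}{2}}-1$. Otherwise (i.e. if $q\not\equiv 1\pmod 8$), $\mathcal{A}=\emptyset$.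
   Context: $\eta$ is the quadratic character of $\mathbb{F}_q$ ($1$ on nonzero squares, $-1$ on nonsquares). For $\mathcal{S}=\{\alpha_1,\dots,\alpha_m\}\subseteq\mathbb{F}_q$, $\Delta_{\mathcal{S}}(\alpha_i)=\prod_{j\neq i}(\alpha_i-\alpha_j)$. For $\boldsymbol\alpha=(\alpha_1,\dots,\alpha_m)$ with distinct entries and $\boldsymbol v\in(\mathbb{F}_q^* )^m$, $GRS_k(\boldsymbol\alpha,\boldsymbol v)=\{(v_1f(\alpha_1),\dots,v_mf(\alpha_m)) : f\in\mathbb{F}_q[x],\deg f\le k-1\}$ and the extended code $GRS_k(\boldsymbol\alpha,\boldsymbol v,\infty)=\{(v_1f(\alpha_1),\dots,v_mf(\alpha_m),f_{k-1})\}$, where $f_{k-1}$ is the coefficient of $x^{k-1}$ in $f$. A linear code $\mathcal{C}\subseteq\mathbb{F}_q^N$ is self-dual if $\mathcal{C}=\mathcal{C}^\perp$ for the Euclidean inner product $\langle u,w\rangle=\sum u_iw_i$; it is MDS if its minimum distance $d$ satisfies $d=N-\dim\mathcal{C}+1$.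
   Formalization: The count |𝒜| = 2^((q−1)/2) − 1 is proved for the collection of such subsets over all even n with 2 ≤ n ≤ q−1 together, since for one fixed n it is false (q = 9, n = 8: only 9 subsets of size 8 exist, but 15 are claimed). *)

theory Defs
  imports
    "HOL-Library.Cardinality"
    "HOL-Computational_Algebra.Polynomial"
    "HOL-Number_Theory.Cong"
    "Jordan_Normal_Form.VS_Connect"
begin

definition quad_char :: "'a::field \<Rightarrow> int" where
  "quad_char x = (if x = 0 then 0 else if (\<exists>y. x = y\<^sup>2) then 1 else -1)"

definition Delta :: "'a::field set \<Rightarrow> 'a \<Rightarrow> 'a" where
  "Delta S a = (\<Prod>b\<in>S - {a}. a - b)"

definition linear_code :: "nat \<Rightarrow> 'a::field vec set \<Rightarrow> bool" where
  "linear_code N C \<longleftrightarrow> VectorSpace.subspace class_ring C (module_vec TYPE('a) N)"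

definition code_dim :: "nat \<Rightarrow> 'a::field vec set \<Rightarrow> nat" where
  "code_dim N C = vectorspace.dim class_ring ((module_vec TYPE('a) N)\<lparr>carrier := C\<rparr>)"

definition hamming_dist :: "'a vec \<Rightarrow> 'a vec \<Rightarrow> nat" where
  "hamming_dist u w = card {i. i < dim_vec u \<and> u $ i \<noteq> w $ i}"

definition min_dist :: "'a vec set \<Rightarrow> nat" where
  "min_dist C = Min {hamming_dist u w | u w. u \<in> C \<and> w \<in> C \<and> u \<noteq> w}"

definition dual_code :: "nat \<Rightarrow> 'a::field vec set \<Rightarrow> 'a vec set" where
  "dual_code N C = {u \<in> carrier_vec N. \<forall>c\<in>C. u \<bullet> c = 0}"

definition MDS :: "nat \<Rightarrow> 'a::field vec set \<Rightarrow> bool" where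
  "MDS N C \<longleftrightarrow> linear_code N C \<and> min_dist C = N - code_dim N C + 1"

definition self_dual :: "nat \<Rightarrow> 'a::field vec set \<Rightarrow> bool" where
  "self_dual N C \<longleftrightarrow> linear_code N C \<and> C = dual_code N C"

text \<open>The degree of the zero polynomial is \<open>0\<close> in the library, so the condition
  \<open>deg f \<le> k - 1\<close>, under which the zero polynomial is always allowed, is spelled
  \<open>f = 0 \<or> degree f < k\<close>.\<close>

definition GRS :: "nat \<Rightarrow> 'a::field vec \<Rightarrow> 'a vec \<Rightarrow> 'a vec set" where
  "GRS k \<alpha> v =
     {vec (dim_vec \<alpha>) (\<lambda>i. v $ i * poly f (\<alpha> $ i)) | f. f = 0 \<or> degree f < k}"

definition GRS_inf :: "nat \<Rightarrow> 'a::field vec \<Rightarrow> 'a vec \<Rightarrow> 'a vec set" where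
  "GRS_inf k \<alpha> v =
     {vec (dim_vec \<alpha>) (\<lambda>i. v $ i * poly f (\<alpha> $ i)) @\<^sub>v vec 1 (\<lambda>_. coeff f (k - 1))
       | f. f = 0 \<or> degree f < k}"

definition nonzero_vecs :: "nat \<Rightarrow> 'a::field vec set" where
  "nonzero_vecs m = {v \<in> carrier_vec m. \<forall>i<m. v $ i \<noteq> 0}"

definition enumerations :: "'a set \<Rightarrow> 'a vec set" where
  "enumerations S = {\<alpha> \<in> carrier_vec (card S). bij_betw (\<lambda>i. \<alpha> $ i) {..<card S} S}"

definition good_subsets_of_size :: "nat \<Rightarrow> 'a::{field,finite} set set" where
  "good_subsets_of_size n =
     {S. card S = n \<and>
         (\<forall>a\<in>S. quad_char (Delta S a) = 1) \<and>
         (\<forall>b\<in>UNIV - S. quad_char (Delta (UNIV - S) b) = 1)}"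

text \<open>The size \<open>n\<close> runs over all even values with \<open>2 \<le> n \<le> q - 1\<close>.  The count
  \<open>2 ^ ((q - 1) div 2) - 1\<close> refers to this whole collection and does not hold for the
  subsets of one fixed size: for \<open>q = 9\<close> there are \<open>9\<close> of size \<open>4\<close>,
  \<open>6\<close> of size \<open>6\<close> and none of size \<open>2\<close> or \<open>8\<close>.\<close>

definition good_subsets :: "'a::{field,finite} set set" where
  "good_subsets =
     (\<Union>n\<in>{n. even n \<and> 2 \<le> n \<and> n \<le> CARD('a) - 1}. good_subsets_of_size n)"

end

theory Submission
  imports Defs "HOL-Library.Z2"
begin

text \<open>Let \<open>P\<close> be the matrix over \<open>GF(2)\<close> with \<open>P i j = 1\<close> iff \<open>i - j\<close> is a nonsquare. For
  \<open>q \<equiv> 1 (mod 4)\<close> it is symmetric with zero row sums, so the two conditions on a set of even size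
  together say that its indicator vector lies in the kernel of \<open>P\<close>. The Jacobsthal sum gives, on
  vectors of even weight, \<open>P\<^sup>2 = P\<close> if \<open>q \<equiv> 1 (mod 8)\<close> and \<open>P\<^sup>2 = P + I\<close> if \<open>q \<equiv> 5 (mod 8)\<close>.
  In the second case the kernel is trivial. In the first, the even vectors split into kernel and
  fixed space of \<open>P\<close>, and these are exchanged by scaling with a nonsquare, so the kernel has
  \<open>2 ^ ((q - 1) / 2)\<close> elements. For \<open>q \<equiv> 3 (mod 4)\<close> counting pairs with nonsquare difference forces
  \<open>4\<close> to divide both \<open>n\<close> and \<open>q - n - 1\<close>, which is impossible.

  Self-duality of the codes comes from \<open>\<Sum> h(\<alpha>\<^sub>i) / \<Delta>(\<alpha>\<^sub>i)\<close> being the coefficient of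
  \<open>x ^ (n - 1)\<close> in \<open>h\<close>, with multipliers satisfying \<open>v\<^sub>i\<^sup>2 = 1 / \<Delta>(\<alpha>\<^sub>i)\<close>, and
  \<open>w\<^sub>i\<^sup>2 = -1 / \<Delta>(\<beta>\<^sub>i)\<close> for the extended code.\<close>

section \<open>Parity from involutions without fixed points\<close>

text \<open>All orbits have exactly two elements; the induction removes one orbit at a time.\<close>

lemma even_card_involution:
  assumes "finite A" "\<And>x. x \<in> A \<Longrightarrow> f x \<in> A" "\<And>x. x \<in> A \<Longrightarrow> f (f x) = x"
    "\<And>x. x \<in> A \<Longrightarrow> f x \<noteq> x"
  shows "even (card A)"
  using assms
proof (induction A rule: finite_psubset_induct)
  case (psubset A)
  show ?case
  proof (cases "A = {}")
    case False
    then obtain a where a: "a \<in> A" by blast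
    let ?B = "A - {a, f a}"
    have "even (card ?B)"
    proof (rule psubset.IH)
      show "?B \<subset> A" using a by blast
      \<comment> \<open>If \<open>f x\<close> were in the removed orbit, applying \<open>f\<close>
        again would put \<open>x\<close> there too.\<close>
      show "f x \<in> ?B" if "x \<in> ?B" for x
        using that psubset.prems a by (metis Diff_iff insert_iff empty_iff)
    qed (use psubset.prems in auto)
    moreover have "card A = card ?B + 2"
    proof -
      have "{a, f a} \<subseteq> A" "a \<noteq> f a" using a psubset.prems by (blast, metis)
      then have "card {a, f a} = 2" "card ?B = card A - card {a, f a}" "card {a, f a} \<le> card A"
        using card_Diff_subset[of "{a, f a}" A] card_mono[of A "{a, f a}"] psubset.hyps by auto
      then show ?thesis by linarith
    qed
    ultimately show ?thesis by simp
  qed simp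
qed

section \<open>The quadratic character\<close>

text \<open>In characteristic 2, translation by 1 is an involution without fixed points, which
  forces an even number of elements.\<close>

lemma two_neq_zero_of_odd_card:
  assumes "odd CARD('a::{field,finite})"
  shows "(2::'a) \<noteq> 0"
proof
  assume "(2::'a) = 0"
  then have "even (card (UNIV :: 'a set))"
    by (intro even_card_involution[of _ "\<lambda>x. x + 1"]) (auto simp: add.assoc)
  with assms show False by simp
qed

lemma neg_neq_self_of_odd_card:
  assumes "odd CARD('a::{field,finite})" "(x::'a) \<noteq> 0"
  shows "- x \<noteq> x"
proof
  assume "- x = x"
  then have "2 * x = 0" by (metis add.right_inverse mult_2)
  with assms two_neq_zero_of_odd_card show False by auto
qed

definition nonzero_squares :: "'a::field set" where
  "nonzero_squares = {x. quad_char x = 1}"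

definition nonsquares :: "'a::field set" where
  "nonsquares = {x. quad_char x = -1}"

lemma quad_char_0 [simp]: "quad_char 0 = 0"
  by (simp add: quad_char_def)

lemma quad_char_eq_0_iff [simp]: "quad_char x = 0 \<longleftrightarrow> x = 0"
  by (simp add: quad_char_def)

lemma quad_char_cases: "x = 0 \<or> quad_char x = 1 \<or> quad_char x = -1"
  by (auto simp: quad_char_def)

lemma quad_char_eq_1_iff: "quad_char x = 1 \<longleftrightarrow> x \<noteq> 0 \<and> (\<exists>y. x = y\<^sup>2)"
  by (auto simp: quad_char_def)

lemma quad_char_1 [simp]: "quad_char 1 = 1"
  unfolding quad_char_eq_1_iff by (metis one_neq_zero one_power2)

text \<open>Squaring is two-to-one on the nonzero elements, with fibres
  \<open>{y, - y}\<close>.\<close>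

lemma card_nonzero_squares:
  assumes "odd CARD('a::{field,finite})"
  shows "2 * card (nonzero_squares :: 'a set) = CARD('a) - 1"
proof -
  let ?U = "UNIV - {0::'a}"
  have im: "(\<lambda>y. y\<^sup>2) ` ?U = nonzero_squares"
    by (auto simp: nonzero_squares_def quad_char_eq_1_iff image_iff)
  have fib: "card {y \<in> ?U. y\<^sup>2 = x} = 2" if "x \<in> nonzero_squares" for x
  proof -
    from that obtain y where y: "y \<noteq> 0" "x = y\<^sup>2" unfolding im[symmetric] by blast
    then have "{y \<in> ?U. y\<^sup>2 = x} = {y, - y}" by (auto simp: power2_eq_iff)
    then show ?thesis using neg_neq_self_of_odd_card[OF assms y(1)] by simp
  qed
  have "card ?U = (\<Sum>x\<in>nonzero_squares. card {y \<in> ?U. y\<^sup>2 = x})"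
    using sum.image_gen[of ?U "\<lambda>_. 1::nat" "\<lambda>y. y\<^sup>2"] im by simp
  also have "\<dots> = 2 * card (nonzero_squares :: 'a set)" using fib by simp
  finally show ?thesis by (simp add: card_Diff_singleton)
qed

lemma card_nonsquares:
  assumes "odd CARD('a::{field,finite})"
  shows "2 * card (nonsquares :: 'a set) = CARD('a) - 1"
proof -
  have "UNIV - {0} = (nonzero_squares \<union> nonsquares :: 'a set)"
    unfolding nonzero_squares_def nonsquares_def using quad_char_cases by auto
  then have "CARD('a) - 1 = card (nonzero_squares \<union> nonsquares :: 'a set)"
    by (metis card_Diff_singleton UNIV_I)
  also have "\<dots> = card (nonzero_squares :: 'a set) + card (nonsquares :: 'a set)"
    by (rule card_Un_disjoint) (auto simp: nonzero_squares_def nonsquares_def)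
  finally show ?thesis using card_nonzero_squares[OF assms] by simp
qed

lemma quad_char_square_mult:
  "y \<noteq> 0 \<Longrightarrow> quad_char (y\<^sup>2 * x) = quad_char x"
proof -
  assume y: "y \<noteq> 0"
  have "(\<exists>z. y\<^sup>2 * x = z\<^sup>2) \<longleftrightarrow> (\<exists>z. x = z\<^sup>2)"
  proof
    assume "\<exists>z. y\<^sup>2 * x = z\<^sup>2"
    then obtain z where "y\<^sup>2 * x = z\<^sup>2" by blast
    then have "x = (z / y)\<^sup>2" using y by (simp add: power_divide field_simps)
    then show "\<exists>z. x = z\<^sup>2" by blast
  qed (metis power_mult_distrib)
  then show ?thesis using y by (simp add: quad_char_def)
qed

text \<open>The product of two nonsquares is a square because multiplication by a nonsquare embeds the
  nonzero squares into the equally large set of nonsquares.\<close>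

lemma quad_char_mult:
  assumes "odd CARD('a::{field,finite})"
  shows "quad_char (x * y :: 'a) = quad_char x * quad_char y"
proof -
  consider "x = 0" | "quad_char x = 1" | "y = 0" | "quad_char y = 1"
    | "quad_char x = -1" "quad_char y = -1"
    using quad_char_cases by blast
  then show ?thesis
  proof cases
    case 2
    then show ?thesis by (auto simp: quad_char_eq_1_iff quad_char_square_mult)
  next
    case 4
    then show ?thesis
      by (auto simp: quad_char_eq_1_iff quad_char_square_mult mult.commute[of x])
  next
    case 5
    then have x0: "x \<noteq> 0" by auto
    have "(*) x ` nonzero_squares = nonsquares"
    proof (rule card_subset_eq)
      show "(*) x ` nonzero_squares \<subseteq> nonsquares"
        using 5 by (auto simp: nonzero_squares_def nonsquares_def quad_char_eq_1_iff
            quad_char_square_mult mult.commute[of x])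
      have "inj_on ((*) x) nonzero_squares" using x0 by (simp add: inj_on_def)
      then show "card ((*) x ` nonzero_squares) = card (nonsquares :: 'a set)"
        using card_nonzero_squares[OF assms] card_nonsquares[OF assms] by (simp add: card_image)
    qed simp
    \<comment> \<open>Writing \<open>y = x * s\<close> with \<open>s\<close> a square turns the
      product \<open>x * y\<close> into the square \<open>x\<^sup>2 * s\<close>.\<close>
    then obtain s where "s \<in> nonzero_squares" "y = x * s"
      using 5(2) unfolding nonsquares_def by blast
    then have "quad_char (x * y) = 1"
      using x0 quad_char_square_mult[OF x0, of s]
      by (simp add: nonzero_squares_def power2_eq_square mult.assoc)
    then show ?thesis using 5 by simp
  qed simp_all
qed

lemma quad_char_prod:
  assumes "odd CARD('a::{field,finite})"
  shows "quad_char (\<Prod>i\<in>I. f i :: 'a) = (\<Prod>i\<in>I. quad_char (f i))"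
  by (induction I rule: infinite_finite_induct) (simp_all add: quad_char_mult[OF assms])

text \<open>There are (q - 1) / 2 nonzero squares, so the question is the parity of this number. If
  -1 is a square, negation pairs them off. If not, inversion pairs off all of them except 1, since
  its only other fixed point, -1, is missing.\<close>

lemma quad_char_minus_one_iff:
  assumes "odd CARD('a::{field,finite})"
  shows "quad_char (-1::'a) = 1 \<longleftrightarrow> CARD('a) mod 4 = 1"
proof -
  let ?Q = "nonzero_squares :: 'a set"
  have one: "1 \<in> ?Q" by (simp add: nonzero_squares_def)
  have pos: "CARD('a) > 0" by simp
  have card: "CARD('a) = 2 * card ?Q + 1" using card_nonzero_squares[OF assms] pos by linarith
  show ?thesis
  proof (cases "quad_char (-1::'a) = 1")
    case True
    have "even (card ?Q)"
    proof (rule even_card_involution[of _ uminus])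
      fix x assume "x \<in> ?Q"
      then show "- x \<in> ?Q"
        using quad_char_mult[OF assms, of "-1" x] True by (simp add: nonzero_squares_def)
      have "x \<noteq> 0" using \<open>x \<in> ?Q\<close> by (auto simp: nonzero_squares_def)
      then show "- x \<noteq> x" by (rule neg_neq_self_of_odd_card[OF assms])
    qed auto
    then show ?thesis using True card by presburger
  next
    case False
    have "even (card (?Q - {1}))"
    proof (rule even_card_involution[of _ inverse])
      fix x assume x: "x \<in> ?Q - {1}"
      then have x0: "x \<noteq> 0" by (auto simp: nonzero_squares_def)
      have "quad_char x * quad_char (inverse x) = 1"
        using x0 by (simp flip: quad_char_mult[OF assms])
      then show "inverse x \<in> ?Q - {1}" using x by (simp add: nonzero_squares_def)
      show "inverse x \<noteq> x"
      proof
        assume "inverse x = x"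
        then have "x * x = 1" using x0 by (metis right_inverse)
        then have "x = 1 \<or> x = -1" by (simp add: square_eq_1_iff)
        then show False using x False by (auto simp: nonzero_squares_def)
      qed
    qed auto
    then have "odd (card ?Q)" using one by (simp add: card_Diff_singleton card_gt_0_iff)
        (metis card_gt_0_iff empty_iff even_diff_nat finite less_one linorder_not_less odd_one)
    then show ?thesis using False card by presburger
  qed
qed

lemma quad_char_minus_comm:
  assumes "odd CARD('a::{field,finite})"
  shows "quad_char (y - x :: 'a) = quad_char (-1::'a) * quad_char (x - y)"
  by (simp flip: quad_char_mult[OF assms])

section \<open>Character sums\<close>

lemma sum_quad_char:
  assumes "odd CARD('a::{field,finite})"
  shows "(\<Sum>x\<in>UNIV. quad_char (x :: 'a)) = 0"
proof -
  have "quad_char (x::'a) = of_bool (x \<in> nonzero_squares) - of_bool (x \<in> nonsquares)" for x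
    using quad_char_cases[of x] by (auto simp: nonzero_squares_def nonsquares_def)
  then have "(\<Sum>x\<in>UNIV. quad_char (x :: 'a))
      = int (card (nonzero_squares :: 'a set)) - int (card (nonsquares :: 'a set))"
    by (simp add: sum_subtractf)
  then show ?thesis using card_nonzero_squares[OF assms] card_nonsquares[OF assms] by simp
qed

lemma sum_quad_char_shift:
  assumes "odd CARD('a::{field,finite})"
  shows "(\<Sum>z\<in>UNIV. quad_char (z - x :: 'a)) = 0"
proof -
  have "(\<Sum>z\<in>UNIV. quad_char (z - x)) = (\<Sum>z\<in>UNIV. quad_char (z :: 'a))"
    by (rule sum.reindex_bij_witness[of _ "\<lambda>z. z + x" "\<lambda>z. z - x"]) auto
  then show ?thesis using sum_quad_char[OF assms] by simp
qed

text \<open>For \<open>z \<noteq> 0\<close> the summand equals \<open>\<eta>(1 + d / z)\<close>, and \<open>1 + d / z\<close> runs over all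
  elements other than \<open>1\<close>.\<close>

lemma sum_quad_char_mult_shift:
  fixes d :: "'a::{field,finite}"
  assumes "odd CARD('a)" "d \<noteq> 0"
  shows "(\<Sum>z\<in>UNIV. quad_char z * quad_char (z + d)) = -1"
proof -
  have eq: "quad_char z * quad_char (z + d) = quad_char (1 + d / z)" if "z \<noteq> 0" for z
  proof -
    have "z * (z + d) = z\<^sup>2 * (1 + d / z)" using that by (simp add: field_simps power2_eq_square)
    then show ?thesis
      using that quad_char_mult[OF assms(1), of z "z + d"] quad_char_square_mult[of z "1 + d / z"]
      by simp
  qed
  have "(\<Sum>z\<in>UNIV. quad_char z * quad_char (z + d))
      = (\<Sum>z\<in>UNIV - {0}. quad_char z * quad_char (z + d))"
    by (rule sum.mono_neutral_right) auto
  also have "\<dots> = (\<Sum>u\<in>UNIV - {1::'a}. quad_char u)"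
    by (rule sum.reindex_bij_witness[of _ "\<lambda>u. d / (u - 1)" "\<lambda>z. 1 + d / z"])
      (use assms(2) eq in auto)
  also have "\<dots> = -1"
    using sum.remove[of "UNIV :: 'a set" 1 quad_char] sum_quad_char[OF assms(1)] by simp
  finally show ?thesis .
qed

text \<open>The product \<open>?t z\<close> is 4 on the set to be counted and 0 elsewhere, except
  that \<open>z = x\<close> and \<open>z = y\<close> each contribute
  \<open>1 - quad_char (x - y)\<close>. The sum over all \<open>z\<close> is known from the
  character sums.\<close>

lemma card_common_nonsquare_neighbours:
  fixes x y :: "'a::{field,finite}"
  assumes odd: "odd CARD('a)" and "x \<noteq> y" and sym: "quad_char (-1::'a) = 1"
  shows "4 * int (card {z. quad_char (z - x) = -1 \<and> quad_char (z - y) = -1})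
    = int CARD('a) - 3 + 2 * quad_char (x - y)"
proof -
  let ?C = "{z. quad_char (z - x) = -1 \<and> quad_char (z - y) = -1}"
  let ?t = "\<lambda>z. (1 - quad_char (z - x)) * (1 - quad_char (z - y))"
  have "(\<Sum>z\<in>UNIV. quad_char (z - x) * quad_char (z - y))
      = (\<Sum>z\<in>UNIV. quad_char z * quad_char (z + (x - y)))"
    by (rule sum.reindex_bij_witness[of _ "\<lambda>z. z + x" "\<lambda>z. z - x"]) auto
  then have J: "(\<Sum>z\<in>UNIV. quad_char (z - x) * quad_char (z - y)) = -1"
    using sum_quad_char_mult_shift[OF odd, of "x - y"] assms(2) by simp
  have "(\<Sum>z\<in>UNIV. ?t z) = (\<Sum>z\<in>UNIV. 1 - quad_char (z - x) - quad_char (z - y)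
      + quad_char (z - x) * quad_char (z - y))"
    by (simp add: algebra_simps)
  also have "\<dots> = int CARD('a) - 1"
    by (simp add: sum.distrib sum_subtractf J sum_quad_char_shift[OF odd])
  finally have total: "(\<Sum>z\<in>UNIV. ?t z) = int CARD('a) - 1" .
  have e: "quad_char (y - x) = quad_char (x - y)"
    using quad_char_minus_comm[OF odd, of y x] sym by simp
  have "(\<Sum>z\<in>UNIV. ?t z) = ?t x + ?t y + (\<Sum>z\<in>UNIV - {x, y}. ?t z)"
    using sum.subset_diff[of "{x, y}" UNIV ?t] assms(2) by simp
  also have "(\<Sum>z\<in>UNIV - {x, y}. ?t z) = (\<Sum>z\<in>UNIV - {x, y}. 4 * of_bool (z \<in> ?C))"
  proof (rule sum.cong)
    fix z assume "z \<in> UNIV - {x, y}"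
    then show "?t z = 4 * of_bool (z \<in> ?C)"
      using quad_char_cases[of "z - x"] quad_char_cases[of "z - y"] by auto
  qed simp
  also have "\<dots> = (\<Sum>z\<in>UNIV. 4 * of_bool (z \<in> ?C))"
    by (rule sum.mono_neutral_left) auto
  also have "\<dots> = 4 * int (card ?C)" by (simp flip: sum_distrib_left)
  finally show ?thesis using total e by (simp add: algebra_simps)
qed

section \<open>The nonsquare Paley matrix modulo 2\<close>

text \<open>Keeping \<open>+\<close> and \<open>*\<close> on \<open>bit\<close> in ring form leaves
  the general lemmas on sums applicable.\<close>

declare add_bit_eq_xor [simp del] mult_bit_eq_and [simp del]

lemma bit_add_self [simp]: "x + x = (0::bit)"
  by (cases x) simp_all

lemma bit_add_self_left [simp]: "x + (x + y) = (y::bit)"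
  by (simp flip: add.assoc)

lemma bit_add_eq_0_iff: "x + y = 0 \<longleftrightarrow> x = (y::bit)"
  by (cases x; cases y) simp_all

lemma of_nat_bit: "(of_nat n :: bit) = of_bool (odd n)"
  by (induction n) auto

definition bit_indicator :: "'a set \<Rightarrow> 'a \<Rightarrow> bit" where
  "bit_indicator S i = of_bool (i \<in> S)"

lemma bij_bit_indicator: "bij (bit_indicator :: 'a set \<Rightarrow> _)"
proof (rule o_bij)
  show "(\<lambda>x. {i. x i = 1}) \<circ> bit_indicator = (id :: 'a set \<Rightarrow> _)"
    by (auto simp: fun_eq_iff bit_indicator_def)
  show "bit_indicator \<circ> (\<lambda>x. {i :: 'a. x i = 1}) = id"
    by (auto simp: fun_eq_iff bit_indicator_def of_bool_def)
qed

lemma card_bit_functions: "card (UNIV :: ('a::finite \<Rightarrow> bit) set) = 2 ^ CARD('a)"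
proof -
  have "card (UNIV :: ('a \<Rightarrow> bit) set) = card (Pow (UNIV :: 'a set))"
    using bij_betw_same_card[OF bij_bit_indicator[where 'a = 'a]] by simp
  then show ?thesis by (simp add: card_Pow)
qed

text \<open>An infinite set has \<open>card\<close> 0, so the positive cardinality just computed
  already implies finiteness.\<close>

lemma finite_bit_functions [simp]: "finite (X :: ('a::finite \<Rightarrow> bit) set)"
proof (rule finite_subset[OF subset_UNIV])
  show "finite (UNIV :: ('a \<Rightarrow> bit) set)"
    by (rule card_ge_0_finite) (simp add: card_bit_functions)
qed

text \<open>Toggling one fixed coordinate exchanges vectors of even and of odd weight.\<close>

lemma card_even_bit_functions:
  "2 * card {x :: 'a::finite \<Rightarrow> bit. sum x UNIV = 0} = 2 ^ CARD('a)"
proof -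
  fix a :: 'a
  let ?E = "{x :: 'a \<Rightarrow> bit. sum x UNIV = 0}" and ?O = "{x :: 'a \<Rightarrow> bit. sum x UNIV = 1}"
  define flip where "flip x = x(a := x a + 1)" for x :: "'a \<Rightarrow> bit"
  have sum_flip: "sum (flip x) UNIV = sum x UNIV + 1" for x
  proof -
    have "sum (flip x) UNIV = x a + 1 + sum x (UNIV - {a})"
      by (simp add: flip_def sum.remove[of UNIV a])
    also have "\<dots> = sum x UNIV + 1" by (simp add: sum.remove[of UNIV a x] add_ac)
    finally show ?thesis .
  qed
  have flip_flip: "flip (flip x) = x" for x
    by (simp add: flip_def add.assoc)
  have "bij_betw flip ?E ?O"
    by (rule bij_betwI[of _ _ _ flip]) (auto simp: sum_flip flip_flip)
  then have "card ?E = card ?O" by (rule bij_betw_same_card)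
  moreover have "card (?E \<union> ?O) = card ?E + card ?O"
    by (rule card_Un_disjoint) auto
  moreover have "?E \<union> ?O = UNIV" by (auto simp flip: bit_not_zero_iff)
  ultimately show ?thesis by (simp add: card_bit_functions)
qed

section \<open>The matrix and its relation to \<open>Delta\<close>\<close>

text \<open>For q \<equiv> 1 (mod 4) this is the adjacency matrix, modulo 2, of the complement of
  the Paley graph.\<close>

definition paley :: "'a::field \<Rightarrow> 'a \<Rightarrow> bit" where
  "paley i j = of_bool (quad_char (i - j) = -1)"

definition paley_map :: "('a::{field,finite} \<Rightarrow> bit) \<Rightarrow> 'a \<Rightarrow> bit" where
  "paley_map x i = (\<Sum>j\<in>UNIV. paley i j * x j)"

text \<open>The parity condition reflects the even size of the subsets. It also makes the all-ones
  matrix act as zero; that matrix appears on scaling by a nonsquare and, for q \<equiv> 5 (mod 8),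
  in the square of the matrix.\<close>

definition paley_kernel :: "('a::{field,finite} \<Rightarrow> bit) set" where
  "paley_kernel = {x. sum x UNIV = 0 \<and> (\<forall>i. paley_map x i = 0)}"

definition paley_fixed :: "('a::{field,finite} \<Rightarrow> bit) set" where
  "paley_fixed = {x. sum x UNIV = 0 \<and> (\<forall>i. paley_map x i = x i)}"

lemma paley_self [simp]: "paley i i = 0"
  by (simp add: paley_def)

lemma paley_map_add: "paley_map (\<lambda>i. x i + y i) i = paley_map x i + paley_map y i"
  by (simp add: paley_map_def distrib_left sum.distrib)

lemma paley_map_indicator:
  "paley_map (bit_indicator S) i = of_bool (odd (card {j \<in> S. quad_char (i - j) = -1}))"
proof -
  have "paley_map (bit_indicator S) i = (\<Sum>j\<in>UNIV. of_bool (j \<in> S \<and> quad_char (i - j) = -1))"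
    unfolding paley_map_def by (rule sum.cong) (auto simp: paley_def bit_indicator_def)
  then show ?thesis by (simp add: of_nat_bit)
qed

text \<open>By multiplicativity each nonsquare factor contributes a sign. The point \<open>a\<close>
  need not be excluded from the count because \<open>quad_char 0\<close> is 0.\<close>

lemma quad_char_Delta:
  assumes "odd CARD('a::{field,finite})"
  shows "quad_char (Delta S (a::'a)) = (-1) ^ card {b \<in> S. quad_char (a - b) = -1}"
proof -
  have "quad_char (Delta S a) = (\<Prod>b\<in>S - {a}. quad_char (a - b))"
    by (simp add: Delta_def quad_char_prod[OF assms])
  also have "\<dots> = (\<Prod>b\<in>S - {a}. if quad_char (a - b) = -1 then -1 else 1)"
  proof (rule prod.cong)
    fix b assume "b \<in> S - {a}"
    then show "quad_char (a - b) = (if quad_char (a - b) = -1 then -1 else 1)"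
      using quad_char_cases[of "a - b"] by auto
  qed simp
  also have "\<dots> = (-1) ^ card {b \<in> S - {a}. quad_char (a - b) = -1}"
    by (simp flip: prod.inter_filter)
  also have "{b \<in> S - {a}. quad_char (a - b) = -1} = {b \<in> S. quad_char (a - b) = -1}"
    by auto
  finally show ?thesis .
qed

text \<open>This turns the multiplicative condition at \<open>a\<close> into a linear equation over
  GF(2).\<close>

lemma quad_char_Delta_eq_1_iff:
  assumes "odd CARD('a::{field,finite})"
  shows "quad_char (Delta S (a::'a)) = 1 \<longleftrightarrow> paley_map (bit_indicator S) a = 0"
  by (simp add: quad_char_Delta[OF assms] paley_map_indicator uminus_power_if)

section \<open>The matrix for q \<equiv> 1 (mod 4)\<close>

context
  assumes q: "CARD('a::{field,finite}) mod 4 = 1"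
begin

lemma odd_card: "odd CARD('a)"
  using q by presburger

lemma minus_one_square: "quad_char (-1::'a) = 1"
  using quad_char_minus_one_iff[OF odd_card] q by simp

lemma paley_sym: "paley (i::'a) j = paley j i"
  using quad_char_minus_comm[OF odd_card, of i j] minus_one_square by (simp add: paley_def)

lemma card_nonsquare_neighbours: "card {z::'a. quad_char (z - x) = -1} = card (nonsquares :: 'a set)"
proof (rule bij_betw_same_card)
  show "bij_betw (\<lambda>z. z - x) {z. quad_char (z - x) = -1} nonsquares"
    by (rule bij_betwI[of _ _ _ "\<lambda>z. z + x"]) (auto simp: nonsquares_def)
qed

lemma even_card_nonsquares: "even (card (nonsquares :: 'a set))"
  using card_nonsquares[OF odd_card] q by presburger

text \<open>Each column has (q - 1) / 2 ones, an even number here.\<close>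

lemma sum_paley: "(\<Sum>k\<in>UNIV. paley k (i::'a)) = 0"
  using even_card_nonsquares
  by (simp add: paley_def of_nat_bit card_nonsquare_neighbours)

text \<open>An entry of the square is the parity of the number of common nonsquare neighbours: (q -
  1) / 2 on the diagonal, and off it (q - 1) / 4 or (q - 5) / 4 according as the difference is a
  square or not.\<close>

lemma paley_square:
  "(\<Sum>k\<in>UNIV. paley (i::'a) k * paley k j) =
    (if i = j then 0 else paley i j + of_bool (CARD('a) mod 8 = 5))"
proof -
  let ?C = "{z::'a. quad_char (z - i) = -1 \<and> quad_char (z - j) = -1}"
  have "(\<Sum>k\<in>UNIV. paley i k * paley k j) = (\<Sum>k\<in>UNIV. of_bool (k \<in> ?C))"
    unfolding paley_sym[of i] by (rule sum.cong) (auto simp: paley_def)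
  also have "\<dots> = of_bool (odd (card ?C))" by (simp add: of_nat_bit)
  finally have eq: "(\<Sum>k\<in>UNIV. paley i k * paley k j) = of_bool (odd (card ?C))" .
  show ?thesis
  proof (cases "i = j")
    case True
    then show ?thesis using eq even_card_nonsquares by (simp add: card_nonsquare_neighbours)
  next
    case False
    from card_common_nonsquare_neighbours[OF odd_card False minus_one_square]
    have c: "4 * int (card ?C) = int CARD('a) - 3 + 2 * quad_char (i - j)" .
    consider "quad_char (i - j) = 1" | "quad_char (i - j) = -1"
      using quad_char_cases[of "i - j"] False by auto
    then show ?thesis
    proof cases
      case 1
      then have "4 * card ?C + 1 = CARD('a)" using c by simp
      then have "odd (card ?C) \<longleftrightarrow> CARD('a) mod 8 = 5" by presburger
      then show ?thesis using eq False 1 by (simp add: paley_def)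
    next
      case 2
      then have "4 * card ?C + 5 = CARD('a)" using c by simp
      then have "even (card ?C) \<longleftrightarrow> CARD('a) mod 8 = 5" by presburger
      then show ?thesis using eq False 2 by (auto simp add: paley_def)
    qed
  qed
qed

text \<open>Column sums vanish, so every image has even weight; this keeps the decomposition into
  kernel and fixed space inside the even vectors.\<close>

lemma sum_paley_map: "(\<Sum>i\<in>UNIV. paley_map x (i::'a)) = 0"
proof -
  have "(\<Sum>i\<in>UNIV. paley_map x (i::'a)) = (\<Sum>j\<in>UNIV. (\<Sum>i\<in>UNIV. paley i j) * x j)"
    unfolding paley_map_def sum_distrib_right by (rule sum.swap)
  then show ?thesis by (simp add: sum_paley)
qed

lemma paley_map_paley_map:
  fixes x :: "'a \<Rightarrow> bit"
  assumes "sum x UNIV = 0"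
  shows "paley_map (paley_map x) i = paley_map x i + of_bool (CARD('a) mod 8 = 5) * x i"
proof -
  let ?c = "of_bool (CARD('a) mod 8 = 5) :: bit"
  have "paley_map (paley_map x) i = (\<Sum>k\<in>UNIV. \<Sum>j\<in>UNIV. paley i k * paley k j * x j)"
    by (simp add: paley_map_def sum_distrib_left mult.assoc)
  also have "\<dots> = (\<Sum>j\<in>UNIV. (\<Sum>k\<in>UNIV. paley i k * paley k j) * x j)"
    unfolding sum_distrib_right by (rule sum.swap)
  \<comment> \<open>The off-diagonal constant \<open>?c\<close> is written as \<open>?c\<close>
    everywhere plus \<open>?c\<close> once more on the diagonal, where the two cancel. The first
    part then vanishes because \<open>x\<close> has even weight.\<close>
  also have "\<dots> = (\<Sum>j\<in>UNIV. paley i j * x j + ?c * x j + (if i = j then ?c * x j else 0))"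
    unfolding paley_square by (rule sum.cong) (auto simp: distrib_right)
  also have "\<dots> = paley_map x i + ?c * sum x UNIV + ?c * x i"
    by (simp add: sum.distrib paley_map_def sum_distrib_left)
  finally show ?thesis using assms by simp
qed

text \<open>A nonsquare factor flips the character, so the matrix is complemented off the
  diagonal.\<close>

lemma paley_scale:
  assumes "quad_char (g::'a) = -1"
  shows "paley (g * i) (g * j) = of_bool (i \<noteq> j) + paley i j"
proof -
  have "quad_char (g * i - g * j) = - quad_char (i - j)"
    using quad_char_mult[OF odd_card, of g "i - j"] assms by (simp add: right_diff_distrib)
  then show ?thesis
    using quad_char_cases[of "i - j"] by (auto simp: paley_def)
qed

lemma sum_scale:
  "(g::'a) \<noteq> 0 \<Longrightarrow> (\<Sum>j\<in>UNIV. f (g * j)) = (\<Sum>j\<in>UNIV. f j)"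
  by (rule sum.reindex_bij_witness[of _ "\<lambda>j. j / g" "\<lambda>j. g * j"]) auto

text \<open>The off-diagonal complement of P is P + I plus the all-ones matrix, and the latter kills
  \<open>x\<close>. Hence scaling carries P to P + I on even vectors.\<close>

lemma paley_map_scale:
  fixes x :: "'a \<Rightarrow> bit"
  assumes g: "quad_char (g::'a) = -1" and x: "sum x UNIV = 0"
  shows "paley_map (\<lambda>i. x (g * i)) i = x (g * i) + paley_map x (g * i)"
proof -
  have g0: "g \<noteq> 0" using g by auto
  have "paley_map x (g * i) = (\<Sum>j\<in>UNIV. paley (g * i) (g * j) * x (g * j))"
    unfolding paley_map_def by (rule sum_scale[OF g0, symmetric])
  also have "\<dots> = (\<Sum>j\<in>UNIV. x (g * j) + (if i = j then x (g * j) else 0) + paley i j * x (g * j))"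
    unfolding paley_scale[OF g] by (rule sum.cong) (auto simp: distrib_right)
  also have "\<dots> = (\<Sum>j\<in>UNIV. x (g * j)) + x (g * i) + paley_map (\<lambda>i. x (g * i)) i"
    by (simp add: sum.distrib paley_map_def)
  also have "(\<Sum>j\<in>UNIV. x (g * j)) = 0"
    using sum_scale[OF g0, of x] x by simp
  finally show ?thesis by (simp flip: add.assoc)
qed

text \<open>Since scaling by a nonsquare \<open>g\<close> exchanges P and P + I, it sends fixed
  vectors to kernel vectors; \<open>inverse g\<close> is again a nonsquare and sends them
  back.\<close>

lemma card_paley_fixed: "card (paley_fixed :: ('a \<Rightarrow> bit) set) = card (paley_kernel :: ('a \<Rightarrow> bit) set)"
proof -
  \<comment> \<open>Nonsquares exist because their number is (q - 1) / 2 and a field has at least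
    the two elements 0 and 1.\<close>
  have "\<exists>g. g \<in> (nonsquares :: 'a set)"
  proof (rule ccontr)
    assume "\<nexists>g. g \<in> (nonsquares :: 'a set)"
    then have "nonsquares = ({} :: 'a set)" by blast
    then have "CARD('a) - 1 = 0" using card_nonsquares[OF odd_card] by simp
    moreover have "card {0, 1::'a} \<le> CARD('a)" by (rule card_mono) auto
    ultimately show False by simp
  qed
  then obtain g :: 'a where g: "quad_char g = -1" by (auto simp: nonsquares_def)
  then have g0: "g \<noteq> 0" by auto
  have "quad_char g * quad_char (inverse g) = 1"
    using g0 by (simp flip: quad_char_mult[OF odd_card])
  then have g': "quad_char (inverse g) = -1" using g by simp
  have "bij_betw (\<lambda>x i. x (g * i)) (paley_fixed :: ('a \<Rightarrow> bit) set) paley_kernel"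
  proof (rule bij_betwI[of _ _ _ "\<lambda>x i. x (inverse g * i)"])
    show "(\<lambda>x i. x (g * i)) \<in> paley_fixed \<rightarrow> paley_kernel"
      using g0 by (auto simp: paley_fixed_def paley_kernel_def paley_map_scale[OF g] sum_scale)
    show "(\<lambda>x i. x (inverse g * i)) \<in> paley_kernel \<rightarrow> paley_fixed"
      using g0 by (auto simp: paley_fixed_def paley_kernel_def paley_map_scale[OF g'] sum_scale)
  qed (use g0 in \<open>auto simp flip: mult.assoc\<close>)
  then show ?thesis by (rule bij_betw_same_card)
qed

text \<open>P is idempotent on even vectors, so x = (x + Px) + Px splits them into kernel and fixed
  space. Both have the same size, whose square is therefore 2 ^ (q - 1).\<close>

lemma card_paley_kernel:
  assumes "CARD('a) mod 8 = 1"
  shows "card (paley_kernel :: ('a \<Rightarrow> bit) set) = 2 ^ ((CARD('a) - 1) div 2)"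
proof -
  let ?E = "{x :: 'a \<Rightarrow> bit. sum x UNIV = 0}"
  have idem: "paley_map (paley_map x) i = paley_map x i" if "sum x UNIV = 0" for x :: "'a \<Rightarrow> bit" and i
    using paley_map_paley_map[OF that] assms by simp
  have "bij_betw (\<lambda>(y, z) i. y i + z i) (paley_kernel \<times> paley_fixed) ?E"
  proof (rule bij_betwI[of _ _ _ "\<lambda>x. (\<lambda>i. x i + paley_map x i, paley_map x)"])
    show "(\<lambda>(y, z) i. y i + z i) \<in> paley_kernel \<times> paley_fixed \<rightarrow> ?E"
      by (auto simp: paley_kernel_def paley_fixed_def sum.distrib)
    show "(\<lambda>x. (\<lambda>i. x i + paley_map x i, paley_map x)) \<in> ?E \<rightarrow> paley_kernel \<times> paley_fixed"
      by (auto simp: paley_kernel_def paley_fixed_def sum.distrib sum_paley_map paley_map_add idem)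
  qed (auto simp: paley_kernel_def paley_fixed_def paley_map_add fun_eq_iff add.assoc)
  then have "card (paley_kernel \<times> paley_fixed :: (('a \<Rightarrow> bit) \<times> ('a \<Rightarrow> bit)) set) = card ?E"
    by (rule bij_betw_same_card)
  then have "2 * (card (paley_kernel :: ('a \<Rightarrow> bit) set))\<^sup>2 = 2 ^ CARD('a)"
    using card_even_bit_functions[where 'a = 'a]
    by (simp add: card_cartesian_product card_paley_fixed power2_eq_square)
  also have "CARD('a) = Suc (2 * ((CARD('a) - 1) div 2))" using odd_card by presburger
  finally have "(card (paley_kernel :: ('a \<Rightarrow> bit) set))\<^sup>2 = (2 ^ ((CARD('a) - 1) div 2))\<^sup>2"
    by (simp add: power_mult mult.commute flip: power_mult)
  then show ?thesis by simp
qed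

text \<open>From P^2 = P + I on even vectors, Px = 0 gives x = 0.\<close>

lemma paley_kernel_trivial:
  assumes "CARD('a) mod 8 = 5"
  shows "(paley_kernel :: ('a \<Rightarrow> bit) set) = {\<lambda>_. 0}"
proof -
  have "x i = 0" if "x \<in> paley_kernel" for x and i :: 'a
  proof -
    from that have "sum x UNIV = 0" and x: "paley_map x = (\<lambda>_. 0)"
      by (auto simp: paley_kernel_def)
    from paley_map_paley_map[OF this(1), of i] assms show ?thesis
      unfolding x by (simp add: paley_map_def)
  qed
  then have "(paley_kernel :: ('a \<Rightarrow> bit) set) \<subseteq> {\<lambda>_. 0}" by blast
  moreover have "(\<lambda>_::'a. 0) \<in> paley_kernel" by (simp add: paley_kernel_def paley_map_def)
  ultimately show ?thesis by blast
qed

section \<open>Good subsets as kernel vectors\<close>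

text \<open>Row sums vanish, so \<open>S\<close> and its complement have the same image. The
  condition on \<open>S\<close> and the one on the complement thus become one equation, required at
  every point of the field.\<close>

lemma good_subset_iff:
  fixes S :: "'a set"
  shows "S \<in> good_subsets_of_size n \<longleftrightarrow> card S = n \<and> (\<forall>i. paley_map (bit_indicator S) i = 0)"
proof -
  have "paley_map (bit_indicator (UNIV - S)) i = paley_map (bit_indicator S) i" for i
  proof -
    have "paley_map (bit_indicator (UNIV - S)) i + paley_map (bit_indicator S) i
        = paley_map (\<lambda>_. 1) i"
      unfolding paley_map_add[symmetric]
      by (rule arg_cong[of _ _ "\<lambda>x. paley_map x i"]) (auto simp: bit_indicator_def fun_eq_iff)
    also have "\<dots> = 0" unfolding paley_map_def paley_sym[of i] by (simp add: sum_paley)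
    finally show ?thesis by (simp add: bit_add_eq_0_iff)
  qed
  then show ?thesis
    by (auto simp: good_subsets_of_size_def quad_char_Delta_eq_1_iff[OF odd_card])
qed

text \<open>The zero vector stands for the empty set, and the full field is excluded by its odd
  size; so for even sizes the bounds only mean that the set is nonempty.\<close>

lemma bij_betw_good_subsets:
  "bij_betw bit_indicator (good_subsets :: 'a set set) (paley_kernel - {\<lambda>_. 0})"
proof -
  have iff: "S \<in> good_subsets \<longleftrightarrow> bit_indicator S \<in> paley_kernel - {\<lambda>_. 0}" for S :: "'a set"
  proof -
    have "(\<Sum>i\<in>UNIV. bit_indicator S i) = of_bool (odd (card S))"
      by (simp add: bit_indicator_def of_nat_bit)
    moreover have "bit_indicator S = (\<lambda>_. 0) \<longleftrightarrow> S = {}"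
      by (auto simp: bit_indicator_def fun_eq_iff)
    moreover have "2 \<le> card S \<and> card S \<le> CARD('a) - 1 \<longleftrightarrow> S \<noteq> {}" if "even (card S)"
    proof
      assume "S \<noteq> {}"
      then have "card S \<noteq> 0" by simp
      moreover have "card S \<noteq> CARD('a)" using that odd_card by metis
      moreover have "card S \<le> CARD('a)" by (simp add: card_mono)
      moreover have "card S \<noteq> 1" using that by auto
      ultimately show "2 \<le> card S \<and> card S \<le> CARD('a) - 1" by linarith
    qed auto
    ultimately show ?thesis
      by (auto simp: good_subsets_def good_subset_iff paley_kernel_def)
  qed
  have "good_subsets = bit_indicator -` (paley_kernel - {\<lambda>_::'a. 0})"
    by (intro Set.set_eqI) (simp only: vimage_eq iff)
  then have "bit_indicator ` good_subsets = paley_kernel - {\<lambda>_::'a. 0}"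
    by (metis surj_image_vimage_eq[OF bij_is_surj[OF bij_bit_indicator]])
  then show ?thesis
    by (intro bij_betw_imageI inj_on_subset[OF bij_is_inj[OF bij_bit_indicator] subset_UNIV])
qed

lemma card_good_subsets:
  "card (good_subsets :: 'a set set) = card (paley_kernel :: ('a \<Rightarrow> bit) set) - 1"
proof -
  have "(\<lambda>_::'a. 0) \<in> paley_kernel" by (simp add: paley_kernel_def paley_map_def)
  then show ?thesis
    using bij_betw_same_card[OF bij_betw_good_subsets] by (simp add: card_Diff_singleton)
qed

end

section \<open>The case q \<equiv> 3 (mod 4)\<close>

text \<open>If \<open>-1\<close> is a nonsquare, exactly half of the ordered pairs of distinct elements of \<open>S\<close> have
  a nonsquare difference.\<close>

lemma four_dvd_of_Delta_squares:
  fixes S :: "'a::{field,finite} set"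
  assumes odd: "odd CARD('a)" and m1: "quad_char (-1::'a) = -1"
    and S: "\<And>a. a \<in> S \<Longrightarrow> quad_char (Delta S a) = 1"
  shows "4 dvd card S * (card S - 1)"
proof -
  let ?N = "SIGMA a:S. {b \<in> S. quad_char (a - b) = -1}"
  let ?Q = "SIGMA a:S. {b \<in> S. quad_char (a - b) = 1}"
  have "even (card {b \<in> S. quad_char (a - b) = -1})" if "a \<in> S" for a
    using S[OF that] by (simp add: quad_char_Delta[OF odd] uminus_power_if split: if_splits)
  then have ev: "even (card ?N)" by (simp add: dvd_sum)
  have swap: "quad_char (a - b) = -1 \<longleftrightarrow> quad_char (b - a) = 1" for a b :: 'a
    using quad_char_minus_comm[OF odd, of a b] m1 by auto
  have "bij_betw prod.swap ?N ?Q"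
    by (rule bij_betwI[of _ _ _ prod.swap]) (auto simp: swap)
  then have "card ?N = card ?Q" by (rule bij_betw_same_card)
  moreover have "card (?N \<union> ?Q) = card ?N + card ?Q"
    by (rule card_Un_disjoint) auto
  moreover have "?N \<union> ?Q = (SIGMA a:S. S - {a})"
  proof -
    have "a \<noteq> b \<longleftrightarrow> quad_char (a - b) = -1 \<or> quad_char (a - b) = 1" for a b :: 'a
      using quad_char_cases[of "a - b"] by auto
    then show ?thesis by blast
  qed
  moreover have "card (SIGMA a:S. S - {a}) = card S * (card S - 1)" by simp
  ultimately have "card S * (card S - 1) = 2 * card ?N" by simp
  then show ?thesis using ev by auto
qed

text \<open>With sizes 2s and 2t + 1 for the set and its complement, the divisibility by 4 makes
  both s and t even, hence q \<equiv> 1 (mod 4).\<close>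

lemma good_subsets_empty_of_minus_one_nonsquare:
  assumes odd: "odd CARD('a::{field,finite})" and "CARD('a) mod 4 = 3"
  shows "(good_subsets :: 'a set set) = {}"
proof (rule ccontr)
  assume "(good_subsets :: 'a set set) \<noteq> {}"
  then obtain S :: "'a set" where S: "even (card S)"
    "\<And>a. a \<in> S \<Longrightarrow> quad_char (Delta S a) = 1"
    "\<And>a. a \<in> UNIV - S \<Longrightarrow> quad_char (Delta (UNIV - S) a) = 1"
    by (auto simp: good_subsets_def good_subsets_of_size_def)
  have m1: "quad_char (-1::'a) = -1"
    using quad_char_minus_one_iff[OF odd] assms(2) quad_char_cases[of "-1::'a"] by auto
  let ?m = "card (UNIV - S)"
  have sum: "card S + ?m = CARD('a)"
    using card_Un_disjoint[of S "UNIV - S"] by simp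
  then have m: "odd ?m" using S(1) odd by presburger
  have "4 dvd card S * (card S - 1)" by (rule four_dvd_of_Delta_squares[OF odd m1 S(2)])
  moreover have "4 dvd ?m * (?m - 1)" by (rule four_dvd_of_Delta_squares[OF odd m1 S(3)])
  moreover obtain s t where st: "card S = 2 * s" "?m = 2 * t + 1"
    using m S(1) by (metis evenE oddE)
  ultimately have "4 dvd 2 * (s * (2 * s - 1))" "4 dvd 2 * ((2 * t + 1) * t)"
    by (simp_all add: ac_simps)
  then have "even (s * (2 * s - 1))" "even ((2 * t + 1) * t)" by presburger+
  then have "even s" by (cases s) auto
  have "even t" using \<open>even ((2 * t + 1) * t)\<close> by simp
  with \<open>even s\<close> sum assms(2) st show False by presburger
qed

section \<open>Self-dual evaluation codes of length \<open>2k\<close>\<close>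

text \<open>This collects what the plain and the extended code share, so that all code parameters
  are derived once. The bound on zeros says that nonzero codewords have weight at least
  \<open>k + 1\<close>.\<close>

locale evaluation_code =
  fixes k :: nat and enc :: "'a::{field,finite} poly \<Rightarrow> 'a vec"
  assumes k_pos: "0 < k"
    and enc_carrier: "enc f \<in> carrier_vec (2 * k)"
    and enc_add: "enc (f + g) = enc f + enc g"
    and enc_smult: "enc (Polynomial.smult c f) = c \<cdot>\<^sub>v enc f"
    and card_zeros: "f \<noteq> 0 \<Longrightarrow> degree f < k \<Longrightarrow> card {i. i < 2 * k \<and> enc f $ i = 0} < k"
    and enc_orthogonal: "degree f < k \<Longrightarrow> degree g < k \<Longrightarrow> enc f \<bullet> enc g = 0"
begin

text \<open>As \<open>k\<close> is positive, the degree bound alone admits the zero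
  polynomial.\<close>

definition code :: "'a vec set" where
  "code = enc ` {f. degree f < k}"

lemma enc_in_code: "degree f < k \<Longrightarrow> enc f \<in> code"
  by (simp add: code_def)

definition poly_of :: "'a vec \<Rightarrow> 'a poly" where
  "poly_of u = (\<Sum>i<k. monom (u $ i) i)"

lemma coeff_poly_of: "coeff (poly_of u) j = (if j < k then u $ j else 0)"
  by (simp add: poly_of_def coeff_sum)

lemma degree_poly_of: "degree (poly_of u) < k"
proof -
  have "degree (poly_of u) \<le> k - 1"
    by (rule degree_le) (auto simp: coeff_poly_of)
  then show ?thesis using k_pos by linarith
qed

lemma poly_of_coeffs:
  assumes "degree f < k"
  shows "poly_of (vec k (coeff f)) = f"
  by (rule poly_eqI) (use assms in \<open>auto simp: coeff_poly_of coeff_eq_0\<close>)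

lemma poly_of_add:
  "u \<in> carrier_vec k \<Longrightarrow> w \<in> carrier_vec k \<Longrightarrow> poly_of (u + w) = poly_of u + poly_of w"
  by (rule poly_eqI) (simp add: coeff_poly_of)

lemma poly_of_smult:
  "u \<in> carrier_vec k \<Longrightarrow> poly_of (c \<cdot>\<^sub>v u) = Polynomial.smult c (poly_of u)"
  by (rule poly_eqI) (simp add: coeff_poly_of)

lemma poly_of_inject:
  assumes "u \<in> carrier_vec k" "w \<in> carrier_vec k" "poly_of u = poly_of w"
  shows "u = w"
proof (rule eq_vecI)
  fix i assume "i < dim_vec w"
  then show "u $ i = w $ i" using assms by (metis coeff_poly_of carrier_vecD)
qed (use assms in auto)

lemma code_eq: "code = (\<lambda>u. enc (poly_of u)) ` carrier_vec k"
proof -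
  have "{f. degree f < k} = poly_of ` carrier_vec k"
    using degree_poly_of by (auto simp: image_iff intro!: bexI[of _ "vec k (coeff _)"] poly_of_coeffs[symmetric])
  then show ?thesis by (simp add: code_def image_image)
qed

lemma enc_diff: "enc (f - g) = enc f - enc g"
proof -
  have "enc (f - g) = enc f + (- 1) \<cdot>\<^sub>v enc g"
    using enc_add[of f "Polynomial.smult (- 1) g"] enc_smult[of "- 1" g] by simp
  also have "\<dots> = enc f - enc g" using enc_carrier[of f] enc_carrier[of g] by auto
  finally show ?thesis .
qed

lemma enc_0: "enc 0 = 0\<^sub>v (2 * k)"
  using enc_diff[of 0 0] enc_carrier[of 0] by (metis diff_zero minus_cancel_vec)

lemma enc_eq_0_imp:
  assumes "degree f < k" "\<And>i. i \<in> I \<Longrightarrow> enc f $ i = 0" "I \<subseteq> {..<2 * k}" "k \<le> card I"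
  shows "f = 0"
proof (rule ccontr)
  assume "f \<noteq> 0"
  have "card I \<le> card {i. i < 2 * k \<and> enc f $ i = 0}"
    by (rule card_mono) (use assms in auto)
  then show False using card_zeros[OF \<open>f \<noteq> 0\<close> assms(1)] assms(4) by simp
qed

text \<open>Two polynomials agreeing on \<open>k\<close> coordinates have a difference with too many
  zeros, so any \<open>k\<close> coordinates determine a codeword.\<close>

lemma inj_on_enc_restrict:
  assumes "I \<subseteq> {..<2 * k}" "k \<le> card I"
  shows "inj_on (\<lambda>f. restrict (\<lambda>i. enc f $ i) I) {f. degree f < k}"
proof (rule inj_onI)
  fix f g assume fg: "f \<in> {f. degree f < k}" "g \<in> {f. degree f < k}"
    and eq: "restrict (\<lambda>i. enc f $ i) I = restrict (\<lambda>i. enc g $ i) I"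
  have "f - g = 0"
  proof (rule enc_eq_0_imp)
    show "degree (f - g) < k" using fg by (simp add: degree_diff_less)
    show "enc (f - g) $ i = 0" if "i \<in> I" for i
    proof -
      have "enc f $ i = enc g $ i" using eq that by (metis restrict_apply')
      then show ?thesis
        using assms(1) that enc_carrier[of g] by (auto simp: enc_diff)
    qed
  qed (use assms in auto)
  then show "f = g" by simp
qed

lemma inj_on_enc: "inj_on enc {f. degree f < k}"
proof (rule inj_onI)
  fix f g assume "f \<in> {f. degree f < k}" "g \<in> {f. degree f < k}" "enc f = enc g"
  then show "f = g"
    by (intro inj_onD[OF inj_on_enc_restrict[of "{..<2 * k}"]]) auto
qed

lemma card_polys: "card {f :: 'a poly. degree f < k} = CARD('a) ^ k"
proof -
  let ?X = "{..<k} \<rightarrow>\<^sub>E (UNIV :: 'a set)"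
  have "bij_betw (\<lambda>f. restrict (coeff f) {..<k}) {f :: 'a poly. degree f < k} ?X"
  proof (rule bij_betwI[of _ _ _ "\<lambda>c. poly_of (vec k c)"])
    show "(\<lambda>c. poly_of (vec k c)) \<in> ?X \<rightarrow> {f. degree f < k}"
      by (auto simp: degree_poly_of)
    show "poly_of (vec k (restrict (coeff f) {..<k})) = f" if "f \<in> {f. degree f < k}" for f
    proof -
      have "vec k (restrict (coeff f) {..<k}) = vec k (coeff f)" by auto
      then show ?thesis using that poly_of_coeffs by simp
    qed
    show "restrict (coeff (poly_of (vec k c))) {..<k} = c" if "c \<in> ?X" for c
      using that by (auto simp: fun_eq_iff coeff_poly_of PiE_def extensional_def)
  qed auto
  then have "card {f :: 'a poly. degree f < k} = card ?X" by (rule bij_betw_same_card)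
  then show ?thesis by (simp add: card_PiE)
qed

text \<open>Restriction to \<open>I\<close> is injective between two sets of the same finite size q
  ^ k, hence surjective.\<close>

lemma interpolation:
  fixes y :: "nat \<Rightarrow> 'a"
  assumes "I \<subseteq> {..<2 * k}" "card I = k"
  obtains f where "degree f < k" "\<And>i. i \<in> I \<Longrightarrow> enc f $ i = y i"
proof -
  let ?F = "\<lambda>f. restrict (\<lambda>i. enc f $ i) I"
  have finI: "finite I" using assms(1) finite_subset by blast
  have "?F ` {f. degree f < k} = (I \<rightarrow>\<^sub>E UNIV)"
  proof (rule card_subset_eq)
    show "finite (I \<rightarrow>\<^sub>E (UNIV :: 'a set))" using finI by (simp add: finite_PiE)
    show "card (?F ` {f. degree f < k}) = card (I \<rightarrow>\<^sub>E (UNIV :: 'a set))"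
      using inj_on_enc_restrict[of I] assms finI by (simp add: card_image card_polys card_PiE)
  qed auto
  moreover have "restrict y I \<in> I \<rightarrow>\<^sub>E UNIV" by auto
  ultimately obtain f where "degree f < k" "restrict y I = ?F f" by blast
  then show ?thesis using that by (metis restrict_apply')
qed

section \<open>Dimension, minimum distance and self-duality\<close>

lemma linear_code_code: "linear_code (2 * k) code"
  unfolding linear_code_def VectorSpace.subspace_def submodule_def module_vec_simps
proof (intro conjI allI impI)
  show "0\<^sub>v (2 * k) \<in> code"
    using enc_in_code[of 0] k_pos enc_0 by simp
  show "v + w \<in> code" if "v \<in> code" "w \<in> code" for v w
  proof -
    from that obtain f g where "v = enc f" "w = enc g" "degree f < k" "degree g < k"
      by (auto simp: code_def)
    then show ?thesis using enc_add[of f g] enc_in_code degree_add_less by metis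
  qed
  show "c \<cdot>\<^sub>v v \<in> code" if "v \<in> code" for c v
  proof -
    from that obtain f where "v = enc f" "degree f < k" by (auto simp: code_def)
    then show ?thesis
      using enc_smult[of c f] enc_in_code le_less_trans[OF degree_smult_le] by metis
  qed
  show "code \<subseteq> carrier_vec (2 * k)" using enc_carrier by (auto simp: code_def)
qed (use vec_vs vec_module in auto)

text \<open>Encoding coefficient vectors is a linear bijection from the \<open>k\<close>-dimensional
  coordinate space onto the code.\<close>

lemma code_dim_code: "code_dim (2 * k) code = k"
proof -
  let ?V = "module_vec TYPE('a) k" and ?W = "(module_vec TYPE('a) (2 * k))\<lparr>carrier := code\<rparr>"
  let ?T = "\<lambda>u. enc (poly_of u)"
  interpret V: vec_space "TYPE('a)" k .
  have W: "vectorspace class_ring ?W"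
    using vectorspace.subspace_is_vs[OF vec_vs] linear_code_code by (auto simp: linear_code_def)
  have "linear_map class_ring ?V ?W ?T"
    unfolding linear_map_def mod_hom_def mod_hom_axioms_def
  proof (intro conjI)
    show "?T \<in> LinearCombinations.module_hom class_ring ?V ?W"
      by (simp add: LinearCombinations.module_hom_def module_vec_simps code_eq poly_of_add poly_of_smult enc_add enc_smult)
    show "module class_ring ?W" using W by (simp add: vectorspace_def)
  qed (use W vec_vs vec_module in auto)
  then have "V.dim = vectorspace.dim class_ring ?W"
  proof (rule linear_map.dim_eq)
    show "V.fin_dim" by simp
    show "inj_on ?T (carrier ?V)"
    proof (rule inj_onI)
      fix u w assume "u \<in> carrier ?V" "w \<in> carrier ?V" "?T u = ?T w"
      moreover from this(3) have "poly_of u = poly_of w"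
        by (rule inj_onD[OF inj_on_enc]) (simp_all add: degree_poly_of)
      ultimately show "u = w" using poly_of_inject by (simp add: module_vec_simps)
    qed
    show "?T ` carrier ?V = carrier ?W" by (simp add: code_eq module_vec_simps)
  qed
  then show ?thesis by (simp add: code_dim_def V.dim_is_n)
qed

text \<open>The additive form avoids truncated subtraction.\<close>

lemma hamming_dist_enc:
  "hamming_dist (enc f) (enc g) + card {i. i < 2 * k \<and> enc (f - g) $ i = 0} = 2 * k"
proof -
  have d: "dim_vec (enc h) = 2 * k" for h using enc_carrier[of h] by auto
  have "{i. i < dim_vec (enc f) \<and> enc f $ i \<noteq> enc g $ i} = {i. i < 2 * k \<and> enc (f - g) $ i \<noteq> 0}"
    by (auto simp: d enc_diff)
  then have "hamming_dist (enc f) (enc g) = card {i. i < 2 * k \<and> enc (f - g) $ i \<noteq> 0}"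
    by (simp add: hamming_dist_def)
  also have "\<dots> + card {i. i < 2 * k \<and> enc (f - g) $ i = 0}
      = card ({i. i < 2 * k \<and> enc (f - g) $ i \<noteq> 0} \<union> {i. i < 2 * k \<and> enc (f - g) $ i = 0})"
    by (rule card_Un_disjoint[symmetric]) auto
  also have "{i. i < 2 * k \<and> enc (f - g) $ i \<noteq> 0} \<union> {i. i < 2 * k \<and> enc (f - g) $ i = 0} = {..<2 * k}"
    by auto
  finally show ?thesis by simp
qed

lemma min_dist_code: "min_dist code = k + 1"
  unfolding min_dist_def
proof (rule Min_eqI)
  let ?D = "{hamming_dist u w |u w. u \<in> code \<and> w \<in> code \<and> u \<noteq> w}"
  have "?D \<subseteq> {..2 * k}"
  proof
    fix d assume "d \<in> ?D"
    then obtain f g where "d = hamming_dist (enc f) (enc g)" by (auto simp: code_def)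
    then show "d \<in> {..2 * k}" using hamming_dist_enc[of f g] by simp
  qed
  then show "finite ?D" using finite_subset by blast
  show "k + 1 \<le> d" if "d \<in> ?D" for d
  proof -
    from that obtain f g where d: "d = hamming_dist (enc f) (enc g)"
      and fg: "degree f < k" "degree g < k" "enc f \<noteq> enc g" by (auto simp: code_def)
    from fg have "f - g \<noteq> 0" by auto
    from card_zeros[OF this degree_diff_less[OF fg(1,2)]] hamming_dist_enc[of f g] d
    show ?thesis by linarith
  qed
  \<comment> \<open>A codeword attaining the bound: it vanishes at \<open>k - 1\<close> prescribed
    coordinates, and the entry 1 at coordinate 0 makes it nonzero.\<close>
  obtain f where f: "degree f < k" "\<And>i. i \<in> {..<k} \<Longrightarrow> enc f $ i = (if i = 0 then 1 else 0)"
    by (rule interpolation[of "{..<k}" "\<lambda>i. if i = 0 then 1 else 0"]) auto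
  have "enc f $ 0 = 1" using f(2)[of 0] k_pos by simp
  then have "f \<noteq> 0" using enc_0 k_pos by auto
  have "card {1..<k} \<le> card {i. i < 2 * k \<and> enc (f - 0) $ i = 0}"
    by (rule card_mono) (use f(2) in auto)
  then have "hamming_dist (enc f) (enc 0) \<le> k + 1" using hamming_dist_enc[of f 0] k_pos by auto
  moreover have "hamming_dist (enc f) (enc 0) \<ge> k + 1"
    using card_zeros[OF \<open>f \<noteq> 0\<close> f(1)] hamming_dist_enc[of f 0] by simp
  moreover have "enc f \<noteq> enc 0"
    using inj_onD[OF inj_on_enc, of f 0] f(1) k_pos \<open>f \<noteq> 0\<close> by auto
  ultimately show "k + 1 \<in> ?D"
    using f(1) k_pos by (intro CollectI exI[of _ "enc f"] exI[of _ "enc 0"]) (auto simp: code_def)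
qed

lemma MDS_code: "MDS (2 * k) code"
  using linear_code_code by (simp add: MDS_def min_dist_code code_dim_code)

text \<open>Subtract from a vector of the dual the codeword that agrees with it on the first half of the
  coordinates; the difference is orthogonal to the code and supported on the second half, where
  codewords take arbitrary values.\<close>

lemma self_dual_code: "self_dual (2 * k) code"
  unfolding self_dual_def
proof (intro conjI linear_code_code equalityI subsetI)
  fix u assume "u \<in> code"
  then show "u \<in> dual_code (2 * k) code"
    using enc_carrier enc_orthogonal by (auto simp: dual_code_def code_def)
next
  fix u assume u: "u \<in> dual_code (2 * k) code"
  then have uc: "u \<in> carrier_vec (2 * k)" by (simp add: dual_code_def)
  obtain f where f: "degree f < k" "\<And>i. i \<in> {..<k} \<Longrightarrow> enc f $ i = u $ i"
    by (rule interpolation[of "{..<k}" "\<lambda>i. u $ i"]) auto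
  have "u $ j = enc f $ j" if j: "j < 2 * k" for j
  proof (cases "j < k")
    case False
    \<comment> \<open>On the second half this codeword is the unit vector at \<open>j\<close>; on
      the first half \<open>u - enc f\<close> vanishes. The inner product therefore isolates the
      entry at \<open>j\<close>.\<close>
    obtain g where g: "degree g < k"
      "\<And>i. i \<in> {k..<2 * k} \<Longrightarrow> enc g $ i = (if i = j then 1 else 0)"
      by (rule interpolation[of "{k..<2 * k}" "\<lambda>i. if i = j then 1 else 0"]) auto
    have "u \<bullet> enc g = 0" using u g(1) by (auto simp: dual_code_def code_def)
    moreover have "enc f \<bullet> enc g = 0" by (rule enc_orthogonal[OF f(1) g(1)])
    ultimately have "(u - enc f) \<bullet> enc g = 0"
      using uc enc_carrier[of f] enc_carrier[of g] by (simp add: minus_scalar_prod_distrib)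
    then have "(\<Sum>i\<in>{0..<2 * k}. (u - enc f) $ i * enc g $ i) = 0"
      using enc_carrier[of g] by (simp add: scalar_prod_def)
    also have "(\<Sum>i\<in>{0..<2 * k}. (u - enc f) $ i * enc g $ i)
        = (\<Sum>i\<in>{0..<2 * k}. if i = j then u $ j - enc f $ j else 0)"
    proof (rule sum.cong)
      fix i assume i: "i \<in> {0..<2 * k}"
      then have "(u - enc f) $ i = u $ i - enc f $ i" using enc_carrier[of f] by auto
      then show "(u - enc f) $ i * enc g $ i = (if i = j then u $ j - enc f $ j else 0)"
        using i f(2)[of i] g(2)[of i] False by (cases "i < k") auto
    qed simp
    finally show ?thesis using j by simp
  qed (use f(2) in auto)
  then have "u = enc f" using uc enc_carrier[of f] by (intro eq_vecI) auto
  then show "u \<in> code" using f(1) by (simp add: code_def)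
qed

end

section \<open>Generalized Reed-Solomon codes\<close>

text \<open>Compare leading coefficients in the Lagrange interpolation formula.\<close>

lemma sum_poly_divide_Delta:
  fixes S :: "'a::field set"
  assumes "finite S" and h: "degree h < card S"
  shows "(\<Sum>a\<in>S. poly h a / Delta S a) = coeff h (card S - 1)"
proof -
  let ?n = "card S - 1"
  \<comment> \<open>The Lagrange basis polynomials before normalisation; they are monic of degree
    \<open>?n\<close>.\<close>
  let ?l = "\<lambda>a. \<Prod>b\<in>S - {a}. [:- b, 1:]"
  let ?L = "\<Sum>a\<in>S. Polynomial.smult (poly h a / Delta S a) (?l a)"
  have deg: "degree (?l a) = ?n" if "a \<in> S" for a
    using that assms(1) by (subst degree_prod_eq_sum_degree) auto
  have "lead_coeff (?l a) = 1" for a by (simp add: lead_coeff_prod)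
  then have lead: "coeff (?l a) ?n = 1" if "a \<in> S" for a using deg[OF that] by metis
  have Delta_nz: "Delta S a \<noteq> 0" for a using assms(1) by (simp add: Delta_def)
  have "degree ?L \<le> ?n"
    by (rule degree_sum_le[OF assms(1)]) (use deg in \<open>auto intro!: order_trans[OF degree_smult_le]\<close>)
  then have degL: "degree ?L < card S" using h by linarith
  have "poly ?L c = poly h c" if c: "c \<in> S" for c
  proof -
    have "poly ?L c = (\<Sum>a\<in>S. poly h a / Delta S a * (\<Prod>b\<in>S - {a}. c - b))"
      by (simp add: poly_sum poly_prod)
    also have "\<dots> = (\<Sum>a\<in>S. if a = c then poly h c else 0)"
    proof (rule sum.cong)
      fix a assume "a \<in> S"
      show "poly h a / Delta S a * (\<Prod>b\<in>S - {a}. c - b) = (if a = c then poly h c else 0)"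
        using Delta_nz[of c] c assms(1) by (auto simp: Delta_def)
    qed simp
    finally show ?thesis using c assms(1) by simp
  qed
  then have "?L = h" using degL h by (intro poly_eqI_degree[of S]) auto
  then have "coeff h ?n = (\<Sum>a\<in>S. poly h a / Delta S a * coeff (?l a) ?n)"
    by (metis (no_types, lifting) coeff_smult coeff_sum sum.cong)
  also have "\<dots> = (\<Sum>a\<in>S. poly h a / Delta S a)" using lead by simp
  finally show ?thesis by simp
qed

section \<open>Enumerated evaluation points and multipliers\<close>

lemma enumerationsD:
  assumes "\<alpha> \<in> enumerations S"
  shows "dim_vec \<alpha> = card S" "bij_betw (\<lambda>i. \<alpha> $ i) {..<card S} S"
  using assms by (auto simp: enumerations_def)

lemma card_enumerated_roots:
  fixes f :: "'a::field poly"
  assumes "\<alpha> \<in> enumerations S" "f \<noteq> 0"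
  shows "card {i. i < card S \<and> poly f (\<alpha> $ i) = 0} \<le> degree f"
proof -
  have "card {i. i < card S \<and> poly f (\<alpha> $ i) = 0}
      = card ((\<lambda>i. \<alpha> $ i) ` {i. i < card S \<and> poly f (\<alpha> $ i) = 0})"
    by (rule card_image[symmetric])
      (use enumerationsD(2)[OF assms(1)] in \<open>auto simp: bij_betw_def inj_on_def\<close>)
  also have "\<dots> \<le> card {x. poly f x = 0}"
    by (rule card_mono) (auto simp: poly_roots_finite[OF assms(2)])
  also have "\<dots> \<le> degree f" by (rule card_poly_roots_bound[OF assms(2)])
  finally show ?thesis .
qed

text \<open>The squared multipliers are the weights of \<open>sum_poly_divide_Delta\<close>, applied
  to \<open>f * g\<close>. The constant \<open>c\<close> is 1 for the plain code and -1 for the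
  extended one.\<close>

lemma scaled_evaluations_scalar_prod:
  fixes \<alpha> :: "'a::field vec"
  assumes "finite S" "\<alpha> \<in> enumerations S"
    and v: "\<And>i. i < card S \<Longrightarrow> (v $ i)\<^sup>2 = c / Delta S (\<alpha> $ i)"
    and deg: "degree (f * g) < card S"
  shows "vec (dim_vec \<alpha>) (\<lambda>i. v $ i * poly f (\<alpha> $ i)) \<bullet> vec (dim_vec \<alpha>) (\<lambda>i. v $ i * poly g (\<alpha> $ i))
    = c * coeff (f * g) (card S - 1)"
proof -
  note e = enumerationsD[OF assms(2)]
  have "vec (dim_vec \<alpha>) (\<lambda>i. v $ i * poly f (\<alpha> $ i)) \<bullet> vec (dim_vec \<alpha>) (\<lambda>i. v $ i * poly g (\<alpha> $ i))
      = (\<Sum>i\<in>{..<card S}. (v $ i)\<^sup>2 * poly (f * g) (\<alpha> $ i))"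
    by (simp add: scalar_prod_def e(1) power2_eq_square ac_simps lessThan_atLeast0)
  also have "\<dots> = (\<Sum>i\<in>{..<card S}. c * (poly (f * g) (\<alpha> $ i) / Delta S (\<alpha> $ i)))"
    using v by (intro sum.cong) auto
  also have "\<dots> = (\<Sum>a\<in>S. c * (poly (f * g) a / Delta S a))"
    by (rule sum.reindex_bij_betw[OF e(2)])
  also have "\<dots> = c * coeff (f * g) (card S - 1)"
    unfolding sum_distrib_left[symmetric] by (subst sum_poly_divide_Delta[OF assms(1) deg]) simp
  finally show ?thesis .
qed

lemma exists_multiplier:
  fixes \<alpha> :: "'a::{field,finite} vec"
  assumes "\<alpha> \<in> enumerations S" "c \<noteq> 0"
    and "\<And>a. a \<in> S \<Longrightarrow> \<exists>y. c / Delta S a = y\<^sup>2"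
  obtains v where "v \<in> nonzero_vecs (card S)" "\<And>i. i < card S \<Longrightarrow> (v $ i)\<^sup>2 = c / Delta S (\<alpha> $ i)"
proof -
  obtain r where r: "\<And>a. a \<in> S \<Longrightarrow> c / Delta S a = (r a)\<^sup>2" using assms(3) by metis
  let ?v = "vec (card S) (\<lambda>i. r (\<alpha> $ i))"
  have mem: "\<alpha> $ i \<in> S" if "i < card S" for i
    using enumerationsD(2)[OF assms(1)] that by (auto simp: bij_betw_def)
  have "Delta S a \<noteq> 0" for a by (simp add: Delta_def)
  then have "r a \<noteq> 0" if "a \<in> S" for a using r[OF that] assms(2) by auto
  then have "?v \<in> nonzero_vecs (card S)" using mem by (simp add: nonzero_vecs_def)
  then show ?thesis using that r mem by simp
qed

lemma degree_mult_less_double: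
  fixes f g :: "'a::field poly"
  assumes "degree f < k" "degree g < k"
  shows "degree (f * g) < 2 * k - 1"
  using degree_mult_le[of f g] assms by linarith

text \<open>Orthogonality holds because \<open>f * g\<close> has degree at most
  \<open>2 * k - 2\<close>, so its coefficient at \<open>2 * k - 1\<close> is zero.\<close>

lemma GRS_MDS_self_dual:
  fixes \<alpha> :: "'a::{field,finite} vec"
  assumes \<alpha>: "\<alpha> \<in> enumerations S" and card: "card S = 2 * k" "0 < k"
    and v: "v \<in> nonzero_vecs (2 * k)" "\<And>i. i < 2 * k \<Longrightarrow> (v $ i)\<^sup>2 = 1 / Delta S (\<alpha> $ i)"
  shows "MDS (2 * k) (GRS k \<alpha> v) \<and> self_dual (2 * k) (GRS k \<alpha> v)"
proof -
  let ?enc = "\<lambda>f. vec (dim_vec \<alpha>) (\<lambda>i. v $ i * poly f (\<alpha> $ i))"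
  note e = enumerationsD[OF \<alpha>, unfolded card]
  interpret evaluation_code k ?enc
  proof
    show "0 < k" by fact
    show "?enc f \<in> carrier_vec (2 * k)" for f using e by simp
    show "?enc (f + g) = ?enc f + ?enc g" for f g by (auto simp: algebra_simps)
    show "?enc (Polynomial.smult c f) = c \<cdot>\<^sub>v ?enc f" for c f by auto
    show "card {i. i < 2 * k \<and> ?enc f $ i = 0} < k" if "f \<noteq> 0" "degree f < k" for f
    proof -
      have "{i. i < 2 * k \<and> ?enc f $ i = 0} = {i. i < card S \<and> poly f (\<alpha> $ i) = 0}"
        using v(1) e(1) card by (auto simp: nonzero_vecs_def)
      then show ?thesis using card_enumerated_roots[OF \<alpha> that(1)] that(2) by simp
    qed
    show "?enc f \<bullet> ?enc g = 0" if "degree f < k" "degree g < k" for f g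
    proof -
      have d: "degree (f * g) < card S - 1" using degree_mult_less_double[OF that] card by simp
      then have "?enc f \<bullet> ?enc g = 1 * coeff (f * g) (card S - 1)"
        by (intro scaled_evaluations_scalar_prod[OF _ \<alpha>]) (use v(2) card in auto)
      then show ?thesis using d by (simp add: coeff_eq_0)
    qed
  qed
  have "GRS k \<alpha> v = code"
    unfolding GRS_def code_def using card(2) by auto
  then show ?thesis using MDS_code self_dual_code by simp
qed

text \<open>Exponents below \<open>k\<close> add up to \<open>2 * k - 2\<close> only if both are
  \<open>k - 1\<close>.\<close>

lemma coeff_mult_top:
  fixes f g :: "'a::field poly"
  assumes "degree f < k" "degree g < k"
  shows "coeff (f * g) (2 * k - 2) = coeff f (k - 1) * coeff g (k - 1)"
proof -
  have "coeff (f * g) (2 * k - 2) = (\<Sum>i\<le>2 * k - 2. coeff f i * coeff g (2 * k - 2 - i))"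
    by (rule coeff_mult)
  also have "\<dots> = (\<Sum>i\<in>{k - 1}. coeff f i * coeff g (2 * k - 2 - i))"
  proof (rule sum.mono_neutral_right)
    show "\<forall>i\<in>{..2 * k - 2} - {k - 1}. coeff f i * coeff g (2 * k - 2 - i) = 0"
    proof
      fix i assume "i \<in> {..2 * k - 2} - {k - 1}"
      then have "i > degree f \<or> 2 * k - 2 - i > degree g" using assms by auto
      then show "coeff f i * coeff g (2 * k - 2 - i) = 0" by (auto simp: coeff_eq_0)
    qed
  qed auto
  also have "\<dots> = coeff f (k - 1) * coeff g (2 * k - 2 - (k - 1))" by simp
  also have "2 * k - 2 - (k - 1) = k - 1" by simp
  finally show ?thesis .
qed

text \<open>The finite coordinates contribute minus the product of the two coefficients at
  \<open>k - 1\<close>, and the last coordinate contributes plus that product.\<close>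

lemma GRS_inf_MDS_self_dual:
  fixes \<beta> :: "'a::{field,finite} vec"
  assumes \<beta>: "\<beta> \<in> enumerations S" and card: "card S = 2 * k - 1" "0 < k"
    and w: "w \<in> nonzero_vecs (2 * k - 1)" "\<And>i. i < 2 * k - 1 \<Longrightarrow> (w $ i)\<^sup>2 = -1 / Delta S (\<beta> $ i)"
  shows "MDS (2 * k) (GRS_inf k \<beta> w) \<and> self_dual (2 * k) (GRS_inf k \<beta> w)"
proof -
  let ?ev = "\<lambda>f. vec (dim_vec \<beta>) (\<lambda>i. w $ i * poly f (\<beta> $ i))"
  let ?top = "\<lambda>f. vec 1 (\<lambda>_. coeff f (k - 1))"
  let ?enc = "\<lambda>f. ?ev f @\<^sub>v ?top f"
  note e = enumerationsD[OF \<beta>, unfolded card]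
  interpret evaluation_code k ?enc
  proof
    show "0 < k" by fact
    show "?enc f \<in> carrier_vec (2 * k)" for f
      using e(1) \<open>0 < k\<close> by (intro carrier_vecI) simp
    show "?enc (f + g) = ?enc f + ?enc g" for f g
      by (rule eq_vecI) (auto simp: algebra_simps)
    show "?enc (Polynomial.smult c f) = c \<cdot>\<^sub>v ?enc f" for c f
      by (rule eq_vecI) auto
    show "card {i. i < 2 * k \<and> ?enc f $ i = 0} < k" if f: "f \<noteq> 0" "degree f < k" for f
    proof -
      let ?R = "{i. i < card S \<and> poly f (\<beta> $ i) = 0}"
      let ?Z = "{i. i < 2 * k \<and> ?enc f $ i = 0}"
      have R: "card ?R \<le> degree f" by (rule card_enumerated_roots[OF \<beta> f(1)])
      have iff: "i \<in> ?Z \<longleftrightarrow> i \<in> ?R \<or> i = 2 * k - 1 \<and> coeff f (k - 1) = 0" for i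
        using w(1) e(1) card by (cases "i < 2 * k - 1") (auto simp: nonzero_vecs_def)
      show ?thesis
      proof (cases "coeff f (k - 1) = 0")
        case True
        \<comment> \<open>A zero in the last coordinate lowers the degree, so this extra zero is
          offset by a root bound smaller by one.\<close>
        then have "degree f \<noteq> k - 1" using f(1) leading_coeff_neq_0 by metis
        then have "degree f < k - 1" using f(2) by linarith
        moreover have "?Z = insert (2 * k - 1) ?R" using iff True by blast
        then have "card ?Z \<le> Suc (card ?R)"
          using card_insert_if[of ?R "2 * k - 1"] by (auto split: if_splits)
        ultimately show ?thesis using R by linarith
      next
        case False
        then have "?Z = ?R" using iff by blast
        then show ?thesis using R f(2) by simp
      qed
    qed
    show "?enc f \<bullet> ?enc g = 0" if "degree f < k" "degree g < k" for f g
    proof -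
      have "?enc f \<bullet> ?enc g = ?ev f \<bullet> ?ev g + ?top f \<bullet> ?top g"
        by (rule scalar_prod_append) auto
      also have "?ev f \<bullet> ?ev g = - 1 * coeff (f * g) (card S - 1)"
        by (rule scaled_evaluations_scalar_prod[OF _ \<beta>])
          (use w(2) card degree_mult_less_double[OF that] in auto)
      also have "card S - 1 = 2 * k - 2" using card by simp
      also have "?top f \<bullet> ?top g = coeff f (k - 1) * coeff g (k - 1)"
        by (simp add: scalar_prod_def)
      finally show ?thesis using coeff_mult_top[OF that] by simp
    qed
  qed
  have "GRS_inf k \<beta> w = code"
    unfolding GRS_inf_def code_def using card(2) by auto
  then show ?thesis using MDS_code self_dual_code by simp
qed

section \<open>The residue classes of q modulo 8 combined\<close>

theorem theorem6p2:
  fixes q :: nat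
  assumes "q = CARD('a::{field,finite})"
    and "odd q"
  shows "([q = 1] (mod 8) \<longrightarrow>
           (\<forall>n. even n \<and> 2 \<le> n \<and> n \<le> q - 1 \<longrightarrow>
             (\<forall>S \<in> (good_subsets_of_size n :: 'a set set).
               \<forall>\<alpha> \<in> enumerations S. \<forall>\<beta> \<in> enumerations (UNIV - S).
                 (\<exists>v \<in> nonzero_vecs n.
                    MDS n (GRS (n div 2) \<alpha> v) \<and> self_dual n (GRS (n div 2) \<alpha> v)) \<and>
                 (\<exists>w \<in> nonzero_vecs (q - n).
                    MDS (q - n + 1) (GRS_inf ((q - n + 1) div 2) \<beta> w) \<and>
                    self_dual (q - n + 1) (GRS_inf ((q - n + 1) div 2) \<beta> w)))) \<and>
           card (good_subsets :: 'a set set) = 2 ^ ((q - 1) div 2) - 1) \<and>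
         (\<not> [q = 1] (mod 8) \<longrightarrow> (good_subsets :: 'a set set) = {})"
proof (intro conjI impI allI ballI)
  assume "[q = 1] (mod 8)"
  then have q8: "CARD('a) mod 8 = 1" using assms(1) by (simp add: cong_def)
  then have q4: "CARD('a) mod 4 = 1" by presburger
  show "card (good_subsets :: 'a set set) = 2 ^ ((q - 1) div 2) - 1"
    using card_good_subsets[OF q4] card_paley_kernel[OF q4 q8] assms(1) by simp
  fix n S \<alpha> \<beta>
  assume n: "even n \<and> 2 \<le> n \<and> n \<le> q - 1" and S: "S \<in> (good_subsets_of_size n :: 'a set set)"
    and \<alpha>: "\<alpha> \<in> enumerations S" and \<beta>: "\<beta> \<in> enumerations (UNIV - S)"
  have cS: "card S = n" and DS: "\<And>a. a \<in> S \<Longrightarrow> quad_char (Delta S a) = 1"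
    and DT: "\<And>a. a \<in> UNIV - S \<Longrightarrow> quad_char (Delta (UNIV - S) a) = 1"
    using S by (auto simp: good_subsets_of_size_def)
  have square: "\<exists>y. c / d = y\<^sup>2" if "quad_char c = 1" "quad_char d = 1" for c d :: 'a
    using that by (metis power_divide quad_char_eq_1_iff)
  show "\<exists>v\<in>nonzero_vecs n. MDS n (GRS (n div 2) \<alpha> v) \<and> self_dual n (GRS (n div 2) \<alpha> v)"
  proof -
    obtain k where k: "n = 2 * k" using n by blast
    obtain v where "v \<in> nonzero_vecs (card S)" "\<And>i. i < card S \<Longrightarrow> (v $ i)\<^sup>2 = 1 / Delta S (\<alpha> $ i)"
      by (rule exists_multiplier[OF \<alpha>, of 1]) (use square DS in auto)
    then show ?thesis using GRS_MDS_self_dual[OF \<alpha>, of k v] n k cS by auto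
  qed
  show "\<exists>w\<in>nonzero_vecs (q - n). MDS (q - n + 1) (GRS_inf ((q - n + 1) div 2) \<beta> w) \<and>
      self_dual (q - n + 1) (GRS_inf ((q - n + 1) div 2) \<beta> w)"
  proof -
    have cT: "card (UNIV - S) = q - n"
      using cS assms(1) by (simp add: card_Diff_subset)
    have "even (q - n + 1)" using n assms(2) by presburger
    then obtain k where k: "q - n + 1 = 2 * k" by blast
    then have k': "q - n = 2 * k - 1" "0 < k" using n by auto
    obtain w where "w \<in> nonzero_vecs (q - n)"
      "\<And>i. i < q - n \<Longrightarrow> (w $ i)\<^sup>2 = -1 / Delta (UNIV - S) (\<beta> $ i)"
      \<comment> \<open>Here -1 is a square, so -1 divided by a square \<open>Delta\<close> still
        has a square root.\<close>
      by (rule exists_multiplier[OF \<beta>, of "-1", unfolded cT])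
        (use square[OF minus_one_square[OF q4]] DT in auto)
    then show ?thesis using GRS_inf_MDS_self_dual[OF \<beta>, of k w] k k' cT by auto
  qed
next
  assume "\<not> [q = 1] (mod 8)"
  then have "CARD('a) mod 8 \<noteq> 1" using assms(1) by (simp add: cong_def)
  moreover note odd = assms(2)[unfolded assms(1)]
  ultimately have "CARD('a) mod 4 = 3 \<or> CARD('a) mod 4 = 1 \<and> CARD('a) mod 8 = 5"
    by presburger
  then consider "CARD('a) mod 4 = 3" | "CARD('a) mod 4 = 1" "CARD('a) mod 8 = 5" by blast
  then show "(good_subsets :: 'a set set) = {}"
  proof cases
    case 1
    then show ?thesis by (rule good_subsets_empty_of_minus_one_nonsquare[OF odd])
  next
    case 2
    \<comment> \<open>Only the zero vector is left in the kernel, and it corresponds to the empty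
      set, which is too small.\<close>
    then have "card (good_subsets :: 'a set set) = 0"
      by (simp only: card_good_subsets paley_kernel_trivial) simp
    then show ?thesis by (simp add: card_eq_0_iff)
  qed
qed

end
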